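(* Let $n\ge 3$, $1\le t<n$, and let $c_1,c_2,\ldots,c_t\in[n]$ be distinct integers such that the sequence $(c_1,\ldots,c_t)$ avoids both patterns $123$ and $132$. Write $\alpha=\max([n]\setminus\{c_1,\ldots,c_t\})$. If $\{c_1,c_2,\ldots,c_{n-\alpha}\}\neq\{\alpha+1,\alpha+2,\ldots,n\}$ or $(c_{n-\alpha+1},c_{n-\alpha+2},\ldots,c_t)\neq(\alpha-1,\alpha-2,\ldots,n-t)$, then $|S_{n,(c_1,\ldots,c_t)}(123,132)|=0$; otherwise, $$|S_{n,(c_1,\ldots,c_t)}(123,132)|=2^{n-t-1}.$$
   Context: $[n]=\{1,\ldots,n\}$ and $S_n$ is the set of permutations of $[n]$ written as sequences $(\tau(1),\ldots,\tau(n))$. A sequence of distinct integers $\tau=(\tau(1),\ldots,\tau(m))$ contains $\sigma\in S_k$ as a pattern if there are indices $1\le i_1<\cdots<i_k\le m$ such that for all $1\le a<b\le k$, $\tau(i_a)<\tau(i_b)$ if and only if $\sigma(a)<\sigma(b)$; otherwise $\tau$ avoids $\sigma$. $S_{n,(c_1,\ldots,c_t)}(\sigma_1,\ldots,\sigma_m)$ is the set of $\tau\in S_n$ with $(\tau(1),\ldots,\tau(t))=(c_1,\ldots,c_t)$ that avoid all of $\sigma_1,\ldots,\sigma_m$. One always has $\alpha\ge n-t$. Both $(c_{n-\alpha+1},\ldots,c_t)$ and $(\alpha-1,\alpha-2,\ldots,n-t)$ are understood as sequences of length $t-(n-\alpha)$; when $\alpha=n-t$ both are empty, hence equal (and then $\{c_1,\ldots,c_t\}=\{n-t+1,\ldots,n\}$).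 When $\alpha=n$, the sets $\{c_1,\ldots,c_{n-\alpha}\}$ and $\{\alpha+1,\ldots,n\}$ are both empty, hence equal. *)

theory Defs
  imports Main "HOL-Combinatorics.Multiset_Permutations"
begin

text \<open>
  Sequences are lists. List positions count from 0, so the entry \<open>\<tau>(i)\<close> of the usual
  one-based notation is \<open>\<tau> ! (i - 1)\<close>; the values of permutations and patterns still
  start at 1. Permutations of \<open>{1..n}\<close> in one-line notation are the elements of
  \<^term>\<open>permutations_of_set {1..n}\<close>.
\<close>

definition contains_pattern :: "'a::linorder list \<Rightarrow> nat list \<Rightarrow> bool" where
  "contains_pattern \<tau> \<sigma> \<longleftrightarrow>
     (\<exists>i :: nat \<Rightarrow> nat.
        strict_mono_on {..<length \<sigma>} i \<and>
        (\<forall>a < length \<sigma>. i a < length \<tau>) \<and>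
        (\<forall>a b. a < b \<and> b < length \<sigma> \<longrightarrow> (\<tau> ! i a < \<tau> ! i b \<longleftrightarrow> \<sigma> ! a < \<sigma> ! b)))"

definition avoids_pattern :: "'a::linorder list \<Rightarrow> nat list \<Rightarrow> bool" where
  "avoids_pattern \<tau> \<sigma> \<longleftrightarrow> \<not> contains_pattern \<tau> \<sigma>"

definition prefix_avoiders :: "nat \<Rightarrow> nat list \<Rightarrow> nat list set \<Rightarrow> nat list set" where
  "prefix_avoiders n c \<Sigma> =
     {\<tau> \<in> permutations_of_set {1..n}.
        take (length c) \<tau> = c \<and> (\<forall>\<sigma>\<in>\<Sigma>. avoids_pattern \<tau> \<sigma>)}"

end

theory Submission
  imports Defs
begin

text \<open>
  A sequence of distinct numbers avoids both \<open>123\<close> and \<open>132\<close> iff no entry is followed by two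
  larger ones, that is, iff each entry is the largest or second largest of the values not yet used.
  So whether a prefix can be extended depends only on the prefix and on the set of remaining
  values, and then each later step but the last offers exactly two choices. The entries of an
  extendable prefix that lie below the largest remaining value \<open>\<alpha>\<close> must decrease, must come after
  all entries above \<open>\<alpha>\<close>, and must exceed every remaining value other than \<open>\<alpha>\<close>.
\<close>

text \<open>The set \<open>S\<close> stands for the entries of a continuation of the list, in unknown order.\<close>

primrec few_above :: "'a::linorder list \<Rightarrow> 'a set \<Rightarrow> bool" where
  "few_above [] S \<longleftrightarrow> True"
| "few_above (x # xs) S \<longleftrightarrow>
     (\<forall>y \<in> set xs \<union> S. \<forall>z \<in> set xs \<union> S. x < y \<longrightarrow> x < z \<longrightarrow> y = z) \<and> few_above xs S"

text \<open>For an entry of \<open>xs\<close> it matters only which values come later, not in which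
  order, so \<open>ys\<close> enters as a set. This separates the condition on a prefix from the
  condition on its continuation.\<close>

lemma few_above_append:
  "few_above (xs @ ys) S \<longleftrightarrow> few_above xs (set ys \<union> S) \<and> few_above ys S"
  by (induction xs) (auto simp: Un_assoc)

section \<open>Pattern avoidance in terms of \<open>few_above\<close>\<close>

lemma contains_pattern_length3:
  "contains_pattern xs [p, q, r] \<longleftrightarrow>
     (\<exists>i j k. i < j \<and> j < k \<and> k < length xs \<and>
        (xs ! i < xs ! j \<longleftrightarrow> p < q) \<and> (xs ! i < xs ! k \<longleftrightarrow> p < r) \<and> (xs ! j < xs ! k \<longleftrightarrow> q < r))"
  (is "?L \<longleftrightarrow> ?R")
proof
  assume ?L
  then obtain f where f: "strict_mono_on {..<3} f" "\<forall>a<3. f a < length xs"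
    and pat: "\<And>a b. a < b \<Longrightarrow> b < 3 \<Longrightarrow> xs ! f a < xs ! f b \<longleftrightarrow> [p, q, r] ! a < [p, q, r] ! b"
    by (auto simp: contains_pattern_def eval_nat_numeral)
  have "f 0 < f 1" "f 1 < f 2" "f 2 < length xs"
    using f by (auto simp: strict_mono_on_def)
  with pat[of 0 1] pat[of 0 2] pat[of 1 2] show ?R
    by (intro exI[of _ "f 0"] exI[of _ "f 1"] exI[of _ "f 2"]) simp
next
  assume ?R
  then obtain i j k where ijk: "i < j" "j < k" "k < length xs"
    "xs ! i < xs ! j \<longleftrightarrow> p < q" "xs ! i < xs ! k \<longleftrightarrow> p < r" "xs ! j < xs ! k \<longleftrightarrow> q < r"
    by blast
  have less3: "a = 0 \<or> a = 1 \<or> a = 2" if "a < length [p, q, r]" for a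
    using that by auto
  show ?L
    unfolding contains_pattern_def
  proof (intro exI[of _ "\<lambda>a. [i, j, k] ! a"] conjI allI impI)
    show "strict_mono_on {..<length [p, q, r]} (\<lambda>a. [i, j, k] ! a)"
      using ijk(1-3) by (auto simp: strict_mono_on_def less_Suc_eq)
  next
    fix a assume "a < length [p, q, r]"
    from less3[OF this] show "[i, j, k] ! a < length xs"
      using ijk(1-3) by auto
  next
    fix a b assume "a < b \<and> b < length [p, q, r]"
    then have "a = 0 \<and> b = 1 \<or> a = 0 \<and> b = 2 \<or> a = 1 \<and> b = 2"
      by auto
    then show "xs ! ([i, j, k] ! a) < xs ! ([i, j, k] ! b) \<longleftrightarrow> [p, q, r] ! a < [p, q, r] ! b"
      using ijk(4-6) by auto
  qed
qed

text \<open>\<open>few_above\<close> compares values while patterns compare positions; distinctness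
  makes two different later positions carry different values.\<close>

lemma few_above_iff_nth:
  assumes "distinct xs"
  shows "few_above xs {} \<longleftrightarrow>
    (\<forall>i j k. i < j \<longrightarrow> j < k \<longrightarrow> k < length xs \<longrightarrow> \<not> (xs ! i < xs ! j \<and> xs ! i < xs ! k))"
  using assms
proof (induction xs)
  case Nil
  then show ?case by simp
next
  case (Cons x xs)
  have "(\<forall>y \<in> set xs. \<forall>z \<in> set xs. x < y \<longrightarrow> x < z \<longrightarrow> y = z) \<longleftrightarrow>
      (\<forall>j k. j < k \<longrightarrow> k < length xs \<longrightarrow> \<not> (x < xs ! j \<and> x < xs ! k))" (is "?A \<longleftrightarrow> ?B")
  proof
    assume ?A
    show ?B
    proof (intro allI impI notI)
      fix j k assume "j < k" "k < length xs" "x < xs ! j \<and> x < xs ! k"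
      with \<open>?A\<close> have "xs ! j = xs ! k" by simp
      with \<open>j < k\<close> \<open>k < length xs\<close> Cons.prems show False
        by (simp add: nth_eq_iff_index_eq)
    qed
  next
    assume ?B
    show ?A
    proof (intro ballI impI)
      fix y z assume "y \<in> set xs" "z \<in> set xs" "x < y" "x < z"
      then obtain j k where "j < length xs" "k < length xs" "y = xs ! j" "z = xs ! k"
        by (auto simp: in_set_conv_nth)
      with \<open>?B\<close> \<open>x < y\<close> \<open>x < z\<close> show "y = z"
        by (metis nat_neq_iff)
    qed
  qed
  moreover have "(\<forall>i j k. i < j \<longrightarrow> j < k \<longrightarrow> k < length (x # xs) \<longrightarrow>
        \<not> ((x # xs) ! i < (x # xs) ! j \<and> (x # xs) ! i < (x # xs) ! k)) \<longleftrightarrow>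
      (\<forall>j k. j < k \<longrightarrow> k < length xs \<longrightarrow> \<not> (x < xs ! j \<and> x < xs ! k)) \<and>
      (\<forall>i j k. i < j \<longrightarrow> j < k \<longrightarrow> k < length xs \<longrightarrow> \<not> (xs ! i < xs ! j \<and> xs ! i < xs ! k))"
    (is "?C \<longleftrightarrow> ?D \<and> ?E")
  proof
    assume C: ?C
    have ?D using C[rule_format, of 0 "Suc _" "Suc _"] by simp
    moreover have ?E using C[rule_format, of "Suc _" "Suc _" "Suc _"] by simp
    ultimately show "?D \<and> ?E" by blast
  next
    assume DE: "?D \<and> ?E"
    show ?C
    proof (intro allI impI)
      \<comment> \<open>Only \<open>i\<close> can be the head position: \<open>i = 0\<close> falls
        under \<open>?D\<close>, any other \<open>i\<close> under \<open>?E\<close>.\<close>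
      fix i j k assume "i < j" "j < k" "k < length (x # xs)"
      moreover from this obtain j' k' where "j = Suc j'" "k = Suc k'"
        by (metis less_imp_Suc_add)
      ultimately show "\<not> ((x # xs) ! i < (x # xs) ! j \<and> (x # xs) ! i < (x # xs) ! k)"
        using DE by (cases i) auto
    qed
  qed
  ultimately show ?case using Cons by simp
qed

text \<open>Two larger entries after a given one form 123 if they ascend and 132 otherwise.\<close>

lemma avoids_123_132_iff_few_above:
  assumes "distinct xs"
  shows "avoids_pattern xs [1, 2, 3] \<and> avoids_pattern xs [1, 3, 2] \<longleftrightarrow> few_above xs {}"
  unfolding few_above_iff_nth[OF assms] avoids_pattern_def contains_pattern_length3
  by simp blast

section \<open>Counting arrangements and continuations\<close>

text \<open>The first entry must be the largest or second largest value of \<open>A\<close>, and the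
  rest is then any such arrangement of the remaining values. Each step doubles the count until one
  value is left.\<close>

lemma card_few_above_permutations:
  fixes A :: "'a::linorder set"
  assumes "finite A" "A \<noteq> {}"
  shows "card {xs \<in> permutations_of_set A. few_above xs {}} = 2 ^ (card A - 1)"
  using assms
proof (induction "card A" arbitrary: A)
  case 0
  then show ?case by simp
next
  case (Suc k)
  define F :: "'a set \<Rightarrow> 'a list set"
    where "F B = {xs \<in> permutations_of_set B. few_above xs {}}" for B
  show ?case
  proof (cases "k = 0")
    case True
    then obtain x where "A = {x}" using Suc.hyps(2) by (metis One_nat_def card_1_singletonE)
    moreover have "{xs. xs = [x] \<and> few_above xs {}} = {[x]}" by auto
    ultimately show ?thesis by simp
  next
    case False
    define m where "m = Max A"
    define m' where "m' = Max (A - {m})"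
    have m: "m \<in> A" "\<And>y. y \<in> A \<Longrightarrow> y \<le> m"
      using Suc.prems by (auto simp: m_def)
    have "card (A - {m}) = k" using Suc.hyps(2) m by simp
    then have "A - {m} \<noteq> {}" using False by (metis card.empty)
    then have m': "m' \<in> A" "m' < m" "\<And>y. y \<in> A \<Longrightarrow> y \<noteq> m \<Longrightarrow> y \<le> m'"
      using Max_in[of "A - {m}"] Suc.prems m(2) by (auto simp: m'_def order.strict_iff_order)
    \<comment> \<open>Any other \<open>x\<close> leaves both \<open>m\<close> and \<open>m'\<close>
      above it; \<open>m'\<close> leaves only \<open>m\<close>, and \<open>m\<close> leaves
      nothing.\<close>
    have head: "(\<forall>y \<in> A - {x}. \<forall>z \<in> A - {x}. x < y \<longrightarrow> x < z \<longrightarrow> y = z) \<longleftrightarrow> x \<in> {m, m'}"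
      if "x \<in> A" for x
    proof
      assume "\<forall>y \<in> A - {x}. \<forall>z \<in> A - {x}. x < y \<longrightarrow> x < z \<longrightarrow> y = z"
      then show "x \<in> {m, m'}"
        using m m' that by (metis DiffI insert_iff order.strict_iff_order singletonD)
    next
      assume "x \<in> {m, m'}"
      then show "\<forall>y \<in> A - {x}. \<forall>z \<in> A - {x}. x < y \<longrightarrow> x < z \<longrightarrow> y = z"
        using m m' by (metis DiffD1 insert_iff leD singletonD)
    qed
    have "F A = (\<Union>x\<in>A. {x # xs |xs. xs \<in> permutations_of_set (A - {x}) \<and> few_above (x # xs) {}})"
      unfolding F_def permutations_of_set_nonempty[OF Suc.prems(2)] by auto
    also have "\<dots> = (\<Union>x\<in>A. {x # xs |xs. x \<in> {m, m'} \<and> xs \<in> F (A - {x})})"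
    proof (intro SUP_cong refl)
      fix x assume "x \<in> A"
      have "few_above (x # xs) {} \<longleftrightarrow> x \<in> {m, m'} \<and> few_above xs {}"
        if "xs \<in> permutations_of_set (A - {x})" for xs
        using head[OF \<open>x \<in> A\<close>] permutations_of_setD(1)[OF that] by simp
      then show "{x # xs |xs. xs \<in> permutations_of_set (A - {x}) \<and> few_above (x # xs) {}} =
          {x # xs |xs. x \<in> {m, m'} \<and> xs \<in> F (A - {x})}"
        unfolding F_def by blast
    qed
    also have "\<dots> = (#) m ` F (A - {m}) \<union> (#) m' ` F (A - {m'})"
      using m m' by auto
    finally have FA: "F A = (#) m ` F (A - {m}) \<union> (#) m' ` F (A - {m'})" .
    have cardF: "card (F (A - {x})) = 2 ^ (k - 1)" if "x \<in> A" for x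
    proof -
      have "card (A - {x}) = k" using that Suc.hyps(2) by simp
      moreover from this have "A - {x} \<noteq> {}" using False by (metis card.empty)
      ultimately show ?thesis
        using Suc.hyps(1)[of "A - {x}"] Suc.prems by (simp add: F_def)
    qed
    \<comment> \<open>The two images are disjoint because their lists start with different
      entries.\<close>
    have "card (F A) = card ((#) m ` F (A - {m})) + card ((#) m' ` F (A - {m'}))"
      unfolding FA using m' by (intro card_Un_disjoint) (auto simp: F_def)
    also have "\<dots> = 2 ^ (k - 1) + 2 ^ (k - 1)"
      using cardF m m' by (simp add: card_image)
    also have "\<dots> = 2 ^ (card A - 1)"
      using False Suc.hyps(2)[symmetric] by (cases k) auto
    finally show ?thesis by (simp add: F_def)
  qed
qed

lemma card_prefix_avoiders_123_132:
  assumes "distinct c" "set c \<subset> {1..n}"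
  shows "card (prefix_avoiders n c {[1, 2, 3], [1, 3, 2]}) =
    (if few_above c ({1..n} - set c) then 2 ^ (n - length c - 1) else 0)"
proof -
  define R where "R = {1..n} - set c"
  have "card R = n - length c"
    using assms by (simp add: R_def card_Diff_subset distinct_card psubset_imp_subset)
  have "R \<noteq> {}" "finite R" using assms by (auto simp: R_def)
  have "prefix_avoiders n c {[1, 2, 3], [1, 3, 2]} =
      (@) c ` {xs \<in> permutations_of_set R. few_above (c @ xs) {}}"
  proof (intro equalityI subsetI)
    fix \<tau> assume "\<tau> \<in> prefix_avoiders n c {[1, 2, 3], [1, 3, 2]}"
    then have \<tau>: "set \<tau> = {1..n}" "distinct \<tau>" "take (length c) \<tau> = c"
      and "avoids_pattern \<tau> [1, 2, 3] \<and> avoids_pattern \<tau> [1, 3, 2]"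
      by (auto simp: prefix_avoiders_def permutations_of_set_def)
    then have "few_above \<tau> {}" using avoids_123_132_iff_few_above by blast
    moreover obtain xs where xs: "\<tau> = c @ xs" by (metis \<tau>(3) append_take_drop_id)
    moreover have "xs \<in> permutations_of_set R"
      using \<tau>(1,2) xs by (auto simp: permutations_of_set_def R_def)
    ultimately show "\<tau> \<in> (@) c ` {xs \<in> permutations_of_set R. few_above (c @ xs) {}}"
      by blast
  next
    fix \<tau> assume "\<tau> \<in> (@) c ` {xs \<in> permutations_of_set R. few_above (c @ xs) {}}"
    then obtain xs where xs: "\<tau> = c @ xs" "set xs = R" "distinct xs" "few_above \<tau> {}"
      by (auto simp: permutations_of_set_def)
    then have "distinct \<tau>" "set \<tau> = {1..n}" using assms by (auto simp: R_def)
    then show "\<tau> \<in> prefix_avoiders n c {[1, 2, 3], [1, 3, 2]}"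
      using xs(1,4) avoids_123_132_iff_few_above[of \<tau>]
      by (auto simp: prefix_avoiders_def permutations_of_set_def)
  qed
  moreover have "few_above (c @ xs) {} \<longleftrightarrow> few_above c R \<and> few_above xs {}"
    if "xs \<in> permutations_of_set R" for xs
    using permutations_of_setD(1)[OF that] by (simp add: few_above_append)
  ultimately have "prefix_avoiders n c {[1, 2, 3], [1, 3, 2]} =
      (@) c ` (if few_above c R then {xs \<in> permutations_of_set R. few_above xs {}} else {})"
    by auto
  then show ?thesis
    using card_few_above_permutations[OF \<open>finite R\<close> \<open>R \<noteq> {}\<close>] \<open>card R = n - length c\<close>
    by (simp add: card_image inj_on_def R_def)
qed

section \<open>The shape of extendable prefixes\<close>

text \<open>Once an entry \<open>x\<close> lies below \<open>a\<close>, the value \<open>a\<close>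
  from \<open>S\<close> is the only larger one allowed after it, so every later entry is below
  \<open>x\<close>.\<close>

lemma few_above_split_at:
  assumes "few_above c S" "a \<in> S" "a \<notin> set c" "distinct c"
  shows "c = filter (\<lambda>x. a < x) c @ filter (\<lambda>x. x < a) c \<and> sorted_wrt (>) (filter (\<lambda>x. x < a) c)"
  using assms
proof (induction c)
  case Nil
  then show ?case by simp
next
  case (Cons x c)
  show ?case
  proof (cases "a < x")
    case True
    with Cons show ?thesis by auto
  next
    case False
    with Cons.prems have "x < a" by auto
    have less_x: "y < x" if "y \<in> set c" for y
    proof (rule ccontr)
      assume "\<not> y < x"
      with that Cons.prems have "x < y" by (metis distinct.simps(2) not_less_iff_gr_or_eq)
      with that Cons.prems \<open>x < a\<close> show False by auto
    qed
    then have "\<forall>y \<in> set c. y < a" using \<open>x < a\<close> by force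
    then have "filter (\<lambda>x. a < x) c = []" "filter (\<lambda>x. x < a) c = c"
      by (auto simp: filter_empty_conv filter_id_conv)
    with Cons \<open>x < a\<close> less_x show ?thesis by auto
  qed
qed

lemma few_above_upward_closed:
  assumes "few_above c S" "a \<in> S" "x \<in> set c" "x < a" "y \<in> S" "x < y"
  shows "y = a"
  using assms by (induction c) auto

lemma few_above_Un:
  assumes "few_above c S" "\<forall>x \<in> set c. \<forall>y \<in> T. y \<le> x"
  shows "few_above c (S \<union> T)"
  using assms by (induction c) (auto simp: leD)

text \<open>Later entries are smaller, so only \<open>S\<close> can supply larger values, and there
  only \<open>a\<close>.\<close>

lemma few_above_decreasing:
  assumes "sorted_wrt (>) c" "\<forall>x \<in> set c. \<forall>y \<in> S. x < y \<longrightarrow> y = a"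
  shows "few_above c S"
  using assms by (induction c) (auto dest: less_asym)

lemma few_above_prefix_iff:
  fixes n :: nat
  assumes "distinct c" "set c \<subset> {1..n}" "few_above c {}"
    and \<alpha>: "\<alpha> = Max ({1..n} - set c)"
  shows "few_above c ({1..n} - set c) \<longleftrightarrow>
    set (take (n - \<alpha>) c) = {\<alpha> + 1..n} \<and> drop (n - \<alpha>) c = rev [n - length c..<\<alpha>]"
proof -
  define R where "R = {1..n} - set c"
  have "R \<noteq> {}" "finite R" using assms by (auto simp: R_def)
  then have "\<alpha> \<in> R" and le_\<alpha>: "\<And>x. x \<in> R \<Longrightarrow> x \<le> \<alpha>"
    using Max_in[of R] \<alpha> by (auto simp: R_def)
  then have "\<alpha> \<notin> set c" "\<alpha> \<le> n" by (auto simp: R_def)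
  have "few_above c R \<longleftrightarrow>
    set (take (n - \<alpha>) c) = {\<alpha> + 1..n} \<and> drop (n - \<alpha>) c = rev [n - length c..<\<alpha>]"
  proof
    assume few: "few_above c R"
    define u where "u = filter (\<lambda>x. \<alpha> < x) c"
    define v where "v = filter (\<lambda>x. x < \<alpha>) c"
    have c: "c = u @ v" and dec: "sorted_wrt (>) v"
      using few_above_split_at[OF few \<open>\<alpha> \<in> R\<close> \<open>\<alpha> \<notin> set c\<close> assms(1)] by (auto simp: u_def v_def)
    have set_u: "set u = {\<alpha> + 1..n}"
    proof (intro equalityI subsetI)
      fix x assume "x \<in> set u"
      with assms(2) show "x \<in> {\<alpha> + 1..n}" by (auto simp: u_def)
    next
      fix x assume "x \<in> {\<alpha> + 1..n}"
      with le_\<alpha>[of x] show "x \<in> set u" by (auto simp: u_def R_def)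
    qed
    have len_u: "length u = n - \<alpha>"
      using distinct_card[of u] assms(1) set_u by (simp add: u_def)
    then have len_v: "length c = (n - \<alpha>) + length v"
      by (subst c) simp
    have card_v: "card (set v) = length v"
      using assms(1) by (intro distinct_card) (simp add: v_def)
    have "set v = {n - length c..<\<alpha>}"
    proof (cases "v = []")
      case True
      \<comment> \<open>Here \<open>n - length c\<close> equals \<alpha>, so the interval is empty
        too.\<close>
      with len_v \<open>\<alpha> \<le> n\<close> show ?thesis by simp
    next
      case False
      \<comment> \<open>The entries below \<alpha> fill the interval from their minimum up to
        \<alpha>; counting them then gives \<open>m = n - length c\<close>.\<close>
      define m where "m = Min (set v)"
      have m: "m \<in> set v" "\<And>x. x \<in> set v \<Longrightarrow> m \<le> x"
        using False by (auto simp: m_def)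
      then have "m \<in> set c" "m < \<alpha>" by (auto simp: v_def)
      have "set v = {m..<\<alpha>}"
      proof (intro equalityI subsetI)
        fix x assume "x \<in> set v"
        with m(2) show "x \<in> {m..<\<alpha>}" by (auto simp: v_def)
      next
        fix x assume x: "x \<in> {m..<\<alpha>}"
        have "x \<notin> R"
          using few_above_upward_closed[OF few \<open>\<alpha> \<in> R\<close> \<open>m \<in> set c\<close> \<open>m < \<alpha>\<close>, of x] x
            \<open>m \<in> set c\<close> by (cases "x = m") (auto simp: R_def)
        moreover have "x \<in> {1..n}" using x \<open>m \<in> set c\<close> assms(2) \<open>\<alpha> \<le> n\<close> by force
        ultimately show "x \<in> set v" using x by (auto simp: v_def R_def)
      qed
      moreover from this have "n - length c = m"
        using card_v len_v \<open>m < \<alpha>\<close> \<open>\<alpha> \<le> n\<close> by simp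
      ultimately show ?thesis by simp
    qed
    \<comment> \<open>A strictly decreasing list is determined by its set; reversal reduces this to
      increasing lists.\<close>
    then have "v = rev [n - length c..<\<alpha>]"
      using dec sorted_distinct_set_unique[of "rev v" "[n - length c..<\<alpha>]"]
      by (simp add: sorted_wrt_rev strict_sorted_iff[symmetric])
        (metis rev_rev_ident sorted_wrt_rev strict_sorted_iff distinct_rev)
    moreover have "take (n - \<alpha>) c = u" "drop (n - \<alpha>) c = v"
      using c len_u by simp_all
    ultimately show "set (take (n - \<alpha>) c) = {\<alpha> + 1..n} \<and> drop (n - \<alpha>) c = rev [n - length c..<\<alpha>]"
      using set_u by simp
  next
    assume cond: "set (take (n - \<alpha>) c) = {\<alpha> + 1..n} \<and> drop (n - \<alpha>) c = rev [n - length c..<\<alpha>]"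
    define u where "u = take (n - \<alpha>) c"
    define v where "v = drop (n - \<alpha>) c"
    have c: "c = u @ v" by (simp add: u_def v_def)
    have set_u: "set u = {\<alpha> + 1..n}" and v: "v = rev [n - length c..<\<alpha>]"
      using cond by (simp_all add: u_def v_def)
    have "few_above u (set v \<union> R)"
    proof (rule few_above_Un)
      show "few_above u (set v)" using assms(3) by (simp add: c few_above_append)
      show "\<forall>x \<in> set u. \<forall>y \<in> R. y \<le> x" using set_u le_\<alpha> by force
    qed
    moreover have "few_above v R"
    proof (rule few_above_decreasing)
      show "sorted_wrt (>) v" by (simp add: v sorted_wrt_rev)
      show "\<forall>x \<in> set v. \<forall>y \<in> R. x < y \<longrightarrow> y = \<alpha>"
      proof (intro ballI impI)
        fix x y assume xy: "x \<in> set v" "y \<in> R" "x < y"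
        then have "y \<notin> set v" "y \<le> \<alpha>" using le_\<alpha> by (auto simp: R_def c)
        with xy show "y = \<alpha>" by (auto simp: v)
      qed
    qed
    ultimately have "few_above (u @ v) R" by (simp add: few_above_append)
    with c show "few_above c R" by simp
  qed
  then show ?thesis by (simp add: R_def)
qed

theorem theorem5p4:
  fixes n t \<alpha> :: nat and c :: "nat list"
  assumes "n \<ge> 3" and "1 \<le> t" and "t < n"
    and "length c = t" and "set c \<subseteq> {1..n}" and "distinct c"
    and "avoids_pattern c [1, 2, 3]" and "avoids_pattern c [1, 3, 2]"
    and "\<alpha> = Max ({1..n} - set c)"
  shows "(set (take (n - \<alpha>) c) \<noteq> {\<alpha> + 1..n} \<or> drop (n - \<alpha>) c \<noteq> rev [n - t..<\<alpha>] \<longrightarrow>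
            card (prefix_avoiders n c {[1, 2, 3], [1, 3, 2]}) = 0) \<and>
         (\<not> (set (take (n - \<alpha>) c) \<noteq> {\<alpha> + 1..n} \<or> drop (n - \<alpha>) c \<noteq> rev [n - t..<\<alpha>]) \<longrightarrow>
            card (prefix_avoiders n c {[1, 2, 3], [1, 3, 2]}) = 2 ^ (n - t - 1))"
proof -
  have "card (set c) = t" using assms by (simp add: distinct_card)
  \<comment> \<open>Since \<open>t < n\<close>, counting rules out equality.\<close>
  then have c: "set c \<subset> {1..n}" using assms by auto
  have "few_above c {}"
    using assms(6-8) avoids_123_132_iff_few_above by blast
  from few_above_prefix_iff[OF assms(6) c this assms(9)]
    card_prefix_avoiders_123_132[OF assms(6) c] assms(4)
  show ?thesis by auto
qed

end
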